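(* Fix $\alpha\in(0,1)$, $\rho\in\mathcal{C}$ and $P\in\mathcal{P}^{\rho}$. Let $Z$ be a random variable with distribution $P$. Then: (i) the map $\theta\mapsto O^\rho(\theta):=\mathrm{E}[\rho_\alpha(Z-\theta)-\rho_\alpha(Z)]$ is well-defined for any $\theta\in\mathbb{R}$, and it is left- and right-differentiable over $\mathbb{R}$, hence also continuous over $\mathbb{R}$. (ii) The corresponding left-derivative $O_-^{\rho\prime}$ and right-derivative $O_+^{\rho\prime}$ satisfy $O_-^{\rho\prime}(\theta)\leq O_+^{\rho\prime}(\theta)$ at any $\theta\in\mathbb{R}$. (iii) For any $\theta\in\mathbb{R}$, the sign of $O_+^{\rho\prime}(\theta)$ is the same as that of $G^\rho(\theta)-\alpha$, where $$G^\rho(\theta):=\frac{\mathrm{E}[|\psi_-(Z-\theta)|\,\mathbb{I}[Z\leq\theta]]}{\mathrm{E}[|\psi_-(Z-\theta)|]}.$$ (iv) $\theta\mapsto G^\rho(\theta)$ is a cumulative distribution function over $\mathbb{R}$. (v) The order-$\alpha$ M-quantile of $P$, defined as $$\theta^\rho_\alpha(P):=\inf\{\theta\in\mathbb{R}: G^\rho(\theta)\geq\alpha\},$$ minimizes $\theta\mapsto O^\rho(\theta)$ over $\mathbb{R}$. (vi) If $\psi_-$ is continuous over $\mathbb{R}$ (or if $P$ is non-atomic), then $G^\rho$ is continuous at $\theta^\rho_\alpha(P)$, so that $G^\rho(\theta^\rho_\alpha(P))=\alpha$.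
   Context: $\mathbb{I}[A]$ is the indicator of $A$. $\mathcal{C}$ is the class of functions $\rho:\mathbb{R}\to\mathbb{R}^+$ that are convex, symmetric ($\rho(-t)=\rho(t)$) and such that $\rho(t)=0$ for $t=0$ only. For $\rho\in\mathcal{C}$, $\psi_-$ denotes the left-derivative of $\rho$, and, for $\alpha\in(0,1)$, $\rho_\alpha(t):=\big((1-\alpha)\mathbb{I}[t<0]+\alpha\mathbb{I}[t>0]\big)\rho(t)$. $\mathcal{P}^\rho$ is the collection of probability measures $P$ over $\mathbb{R}$ such that $P[\{\theta\}]<1$ for any $\theta\in\mathbb{R}$ and $\int_{-\infty}^\infty|\psi_-(z-\theta)|\,dP(z)<\infty$ for any $\theta\in\mathbb{R}$. *)

theory Defs
  imports "HOL-Probability.Probability"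
begin

(* One-sided derivatives.  As usual for THE, the values are meaningful only where the
   one-sided derivative exists. *)
definition left_deriv :: "(real \<Rightarrow> real) \<Rightarrow> real \<Rightarrow> real" where
  "left_deriv f x = (THE D. (f has_real_derivative D) (at_left x))"

definition right_deriv :: "(real \<Rightarrow> real) \<Rightarrow> real \<Rightarrow> real" where
  "right_deriv f x = (THE D. (f has_real_derivative D) (at_right x))"

definition loss_class :: "(real \<Rightarrow> real) set" where
  "loss_class = {\<rho>. convex_on UNIV \<rho> \<and> (\<forall>t. 0 \<le> \<rho> t) \<and>
                    (\<forall>t. \<rho> (- t) = \<rho> t) \<and> (\<forall>t. \<rho> t = 0 \<longleftrightarrow> t = 0)}"

definition tilted :: "(real \<Rightarrow> real) \<Rightarrow> real \<Rightarrow> real \<Rightarrow> real" where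
  "tilted \<rho> \<alpha> t = ((1 - \<alpha>) * of_bool (t < 0) + \<alpha> * of_bool (t > 0)) * \<rho> t"

(* real_distribution P: P is a probability measure on the Borel sets of the real line. *)
definition prob_class :: "(real \<Rightarrow> real) \<Rightarrow> real measure set" where
  "prob_class \<rho> = {P. real_distribution P \<and> (\<forall>\<theta>. measure P {\<theta>} < 1) \<and>
                     (\<forall>\<theta>. integrable P (\<lambda>z. \<bar>left_deriv \<rho> (z - \<theta>)\<bar>))}"

definition M_objective ::
    "(real \<Rightarrow> real) \<Rightarrow> real \<Rightarrow> 'w measure \<Rightarrow> ('w \<Rightarrow> real) \<Rightarrow> real \<Rightarrow> real" where
  "M_objective \<rho> \<alpha> M Z \<theta> = (\<integral>\<omega>. tilted \<rho> \<alpha> (Z \<omega> - \<theta>) - tilted \<rho> \<alpha> (Z \<omega>) \<partial>M)"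

definition M_cdf ::
    "(real \<Rightarrow> real) \<Rightarrow> 'w measure \<Rightarrow> ('w \<Rightarrow> real) \<Rightarrow> real \<Rightarrow> real" where
  "M_cdf \<rho> M Z \<theta> =
     (\<integral>\<omega>. \<bar>left_deriv \<rho> (Z \<omega> - \<theta>)\<bar> * of_bool (Z \<omega> \<le> \<theta>) \<partial>M) /
     (\<integral>\<omega>. \<bar>left_deriv \<rho> (Z \<omega> - \<theta>)\<bar> \<partial>M)"

(* The quantile is a functional of the distribution P, so the underlying random variable with
   distribution P is taken to be the identity on the probability space P itself. *)
definition M_quantile :: "(real \<Rightarrow> real) \<Rightarrow> real \<Rightarrow> real measure \<Rightarrow> real" where
  "M_quantile \<rho> \<alpha> P = Inf {\<theta>. M_cdf \<rho> P (\<lambda>z. z) \<theta> \<ge> \<alpha>}"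

end

theory Submission
  imports Defs
begin

text \<open>
  Everything is driven by one inequality. A function \<open>f\<close> on the line is convex as soon as it has
  a subgradient at each point, and if the chosen subgradient \<open>S\<close> is right-continuous then, being
  squeezed between \<open>S x\<close> and \<open>S y\<close>, the difference quotients over \<open>[x, y]\<close> converge to \<open>S x\<close>:
  the right derivative of \<open>f\<close> is \<open>S\<close>. The left derivative exists by convexity alone and is
  at most the right one. Subgradient inequalities survive integration, so no limit
  of difference quotients ever has to be exchanged with an expectation.

  Write \<open>\<psi>\<close> for the left derivative of \<open>\<rho>\<close>. It is an increasing, left-continuous subgradient of
  \<open>\<rho>\<close> (\<open>left_deriv_is_subgradient\<close>, \<open>left_deriv_left_continuous\<close>), negative to the left of \<open>0\<close> and
  positive to the right, with \<open>\<psi> 0 \<le> 0\<close>. Hence the tilted loss has the subgradient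
  \<open>(1 - \<alpha>) min \<psi> 0 + \<alpha> max \<psi> 0\<close> (\<open>tilted_is_subgradient\<close>), and integration
  (\<open>expected_loss_is_subgradient\<close>) shows that the objective has the subgradient
  \<open>(1 - \<alpha>) A \<theta> - \<alpha> B \<theta>\<close>, where \<open>A \<theta>\<close> and \<open>B \<theta>\<close> are the expectations of the negative and of the
  positive part of \<open>\<psi> (Z - \<theta>)\<close>. By dominated convergence (\<open>expected_translate_continuous\<close>) \<open>A\<close> and
  \<open>B\<close> inherit right-continuity from the left-continuity of \<open>\<psi>\<close>, so this is the right derivative.

  Since \<open>\<bar>\<psi> (Z - \<theta>)\<bar> of_bool (Z \<le> \<theta>)\<close> is exactly the negative part, \<open>G = A / (A + B)\<close>, and the right
  derivative is \<open>(A + B) (G - \<alpha>)\<close>, which gives its sign. Here \<open>A\<close> increases from \<open>0\<close> and \<open>B\<close> decreases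
  to \<open>0\<close>, so \<open>G\<close> is a distribution function (\<open>ratio_is_cdf\<close>). The objective thus decreases to the left
  of the \<open>\<alpha>\<close>-quantile of \<open>G\<close> and has a nonnegative subgradient there, which makes the quantile a
  minimizer. Finally, \<open>A\<close> and \<open>B\<close> are continuous at any \<open>\<theta>\<close> for which \<open>Z - \<theta>\<close> almost surely avoids
  the countably many jumps of \<open>\<psi>\<close>; both hypotheses of the last claim ensure this.
\<close>

section \<open>Subgradients and one-sided derivatives on the line\<close>

text \<open>
  One subgradient is selected at each point, rather than the whole subdifferential, so that
  monotonicity, continuity and expectations of the subgradients are those of a real function.
\<close>

definition subgradient_of :: "(real \<Rightarrow> real) \<Rightarrow> (real \<Rightarrow> real) \<Rightarrow> bool" where
  "subgradient_of f S \<longleftrightarrow> (\<forall>x y. f x + S x * (y - x) \<le> f y)"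

lemma subgradient_ofD: "subgradient_of f S \<Longrightarrow> f x + S x * (y - x) \<le> f y"
  by (simp add: subgradient_of_def)

lemma subgradient_le_slope:
  assumes "subgradient_of f S" "x < y"
  shows "S x \<le> (f y - f x) / (y - x)" and "(f y - f x) / (y - x) \<le> S y"
  using subgradient_ofD[OF assms(1), of x y] subgradient_ofD[OF assms(1), of y x] assms(2)
  by (auto simp: field_simps)

lemma subgradient_mono:
  assumes "subgradient_of f S" shows "mono S"
proof (rule monoI)
  fix x y :: real assume "x \<le> y"
  then show "S x \<le> S y"
    using subgradient_le_slope[OF assms, of x y] by (cases "x = y") auto
qed

text \<open>At an intermediate point \<open>z\<close> the line of slope \<open>S z\<close> lies below both end points.\<close>

lemma subgradient_imp_convex:
  assumes "subgradient_of f S" shows "convex_on UNIV f"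
proof
  fix t x y :: real
  assume t: "t > 0" "t < 1"
  define z where "z = (1 - t) * x + t * y"
  have "(1 - t) * (f z + S z * (x - z)) \<le> (1 - t) * f x"
    using t subgradient_ofD[OF assms] by (intro mult_left_mono) auto
  moreover have "t * (f z + S z * (y - z)) \<le> t * f y"
    using t subgradient_ofD[OF assms] by (intro mult_left_mono) auto
  moreover have "(1 - t) * (f z + S z * (x - z)) + t * (f z + S z * (y - z)) = f z"
    by (simp add: z_def algebra_simps)
  ultimately show "f ((1 - t) *\<^sub>R x + t *\<^sub>R y) \<le> (1 - t) * f x + t * f y"
    by (simp add: z_def)
qed simp

lemma subgradient_imp_continuous:
  assumes "subgradient_of f S" shows "continuous_on UNIV f"
  by (rule convex_on_continuous[OF open_UNIV subgradient_imp_convex[OF assms]])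

lemma left_deriv_eqI:
  assumes "(f has_real_derivative D) (at_left x)" shows "left_deriv f x = D"
  unfolding left_deriv_def
proof (rule the_equality)
  show "(f has_real_derivative D) (at_left x)" by (rule assms)
  fix D' assume "(f has_real_derivative D') (at_left x)"
  then show "D' = D"
    using assms tendsto_unique[OF trivial_limit_at_left_real] by (auto simp: has_field_derivative_iff)
qed

lemma right_deriv_eqI:
  assumes "(f has_real_derivative D) (at_right x)" shows "right_deriv f x = D"
  unfolding right_deriv_def
proof (rule the_equality)
  show "(f has_real_derivative D) (at_right x)" by (rule assms)
  fix D' assume "(f has_real_derivative D') (at_right x)"
  then show "D' = D"
    using assms tendsto_unique[OF trivial_limit_at_right_real] by (auto simp: has_field_derivative_iff)
qed

lemma slope_commute:
  fixes f :: "real \<Rightarrow> real"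
  shows "(f y - f x) / (y - x) = (f x - f y) / (x - y)"
  using minus_divide_divide[of "f y - f x" "y - x"] by simp

lemma convex_slopes:
  fixes f :: "real \<Rightarrow> real"
  assumes "convex_on UNIV f" "a < b" "b < c"
  shows "(f b - f a) / (b - a) \<le> (f c - f a) / (c - a)"
    and "(f c - f a) / (c - a) \<le> (f c - f b) / (c - b)"
  using convex_on_slope_le[OF assms(1), of a c b] assms(2,3)
  by (simp_all add: slope_commute[of f a] slope_commute[of f b c])

text \<open>
  The slopes of the chords that end at \<open>x\<close> increase with the other end point, and to the left of
  \<open>x\<close> they stay below the slope over \<open>[x, x + 1]\<close>, so they converge.
\<close>

lemma convex_has_left_deriv:
  fixes f :: "real \<Rightarrow> real"
  assumes f: "convex_on UNIV f"
  shows "(f has_real_derivative left_deriv f x) (at_left x)"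
proof -
  let ?q = "\<lambda>y. (f y - f x) / (y - x)"
  note flip = slope_commute[of f _ x]
  have "(?q \<longlongrightarrow> Sup (?q ` ({..<x} \<inter> UNIV))) (at x within ({..<x} \<inter> UNIV))"
  proof (rule Lim_left_bound)
    fix a b assume "a \<le> b" "b < x"
    then show "?q a \<le> ?q b"
      using convex_slopes(2)[OF f, of a b x] by (cases "a = b") (auto simp: flip)
  next
    fix b assume "b < x"
    then show "?q b \<le> f (x + 1) - f x"
      using convex_slopes[OF f, of b x "x + 1"] by (auto simp: flip)
  qed
  then have "(f has_real_derivative Sup (?q ` {..<x})) (at_left x)"
    by (simp add: has_field_derivative_iff)
  with left_deriv_eqI[OF this] show ?thesis by simp
qed

lemma left_deriv_is_subgradient:
  fixes f :: "real \<Rightarrow> real"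
  assumes f: "convex_on UNIV f"
  shows "subgradient_of f (left_deriv f)"
  unfolding subgradient_of_def
proof (intro allI)
  fix x y
  let ?q = "\<lambda>y. (f y - f x) / (y - x)"
  note flip = slope_commute[of f _ x]
  have lim: "(?q \<longlongrightarrow> left_deriv f x) (at_left x)"
    using convex_has_left_deriv[OF f] by (simp add: has_field_derivative_iff)
  consider "y < x" | "y = x" | "x < y" by linarith
  then show "f x + left_deriv f x * (y - x) \<le> f y"
  proof cases
    case 1
    have "eventually (\<lambda>z. ?q y \<le> ?q z) (at_left x)"
      using eventually_at_left_real[OF 1]
    proof eventually_elim
      case (elim z)
      then show ?case using convex_slopes(2)[OF f, of y z x] by (simp add: flip)
    qed
    then have "?q y \<le> left_deriv f x"
      by (rule tendsto_lowerbound[OF lim]) simp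
    with 1 show ?thesis by (simp add: field_simps)
  next
    case 3
    have "eventually (\<lambda>z. ?q z \<le> ?q y) (at_left x)"
      using eventually_at_left_real[of "x - 1" x, simplified]
    proof eventually_elim
      case (elim z)
      then show ?case using convex_slopes[OF f, of z x y] 3 by (simp add: flip)
    qed
    then have "left_deriv f x \<le> ?q y"
      by (rule tendsto_upperbound[OF lim]) simp
    with 3 show ?thesis by (simp add: field_simps)
  qed simp
qed

text \<open>
  A chord \<open>[y, x]\<close> whose slope nearly attains the left derivative at \<open>x\<close> keeps almost the same slope
  when its right end \<open>x\<close> is moved slightly to the left, to \<open>z\<close>; and that slope is at most the left
  derivative at \<open>z\<close>.
\<close>

lemma left_deriv_left_continuous:
  fixes f :: "real \<Rightarrow> real"
  assumes f: "convex_on UNIV f"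
  shows "(left_deriv f \<longlongrightarrow> left_deriv f x) (at_left x)"
proof (rule order_tendstoI)
  note sub = left_deriv_is_subgradient[OF f]
  fix a assume a: "a < left_deriv f x"
  have lim: "((\<lambda>y. (f y - f x) / (y - x)) \<longlongrightarrow> left_deriv f x) (at_left x)"
    using convex_has_left_deriv[OF f] by (simp add: has_field_derivative_iff)
  have "eventually (\<lambda>y. a < (f y - f x) / (y - x) \<and> y \<in> {x - 1<..<x}) (at_left x)"
    by (intro eventually_conj order_tendstoD(1)[OF lim a] eventually_at_left_real) simp
  then obtain y where y: "a < (f y - f x) / (y - x)" "y < x"
    using eventually_happens'[OF trivial_limit_at_left_real] by fastforce
  have "isCont f x"
    using subgradient_imp_continuous[OF sub] by (simp add: continuous_on_eq_continuous_at)
  then have "((\<lambda>z. (f z - f y) / (z - y)) \<longlongrightarrow> (f x - f y) / (x - y)) (at_left x)"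
    using y(2) by (intro tendsto_intros) (auto simp: isCont_def intro: tendsto_within_subset)
  moreover have "a < (f x - f y) / (x - y)"
    using y by (simp add: slope_commute[of f y x])
  ultimately have "eventually (\<lambda>z. a < (f z - f y) / (z - y)) (at_left x)"
    by (rule order_tendstoD(1))
  with eventually_at_left_real[OF y(2)] show "eventually (\<lambda>z. a < left_deriv f z) (at_left x)"
  proof eventually_elim
    case (elim z)
    then show ?case using subgradient_le_slope(2)[OF sub, of y z] by simp
  qed
next
  fix a assume a: "left_deriv f x < a"
  show "eventually (\<lambda>z. left_deriv f z < a) (at_left x)"
    using eventually_at_left_real[of "x - 1" x, simplified]
  proof eventually_elim
    case (elim z)
    then show ?case
      using monoD[OF subgradient_mono[OF left_deriv_is_subgradient[OF f]], of z x] a by simp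
  qed
qed

lemma right_continuous_subgradient_is_right_deriv:
  assumes sub: "subgradient_of f S" and S: "(S \<longlongrightarrow> S x) (at_right x)"
  shows "(f has_real_derivative S x) (at_right x)"
  unfolding has_field_derivative_iff
proof (rule tendsto_sandwich[OF _ _ tendsto_const S])
  show "eventually (\<lambda>y. S x \<le> (f y - f x) / (y - x)) (at_right x)"
    using eventually_at_right_real[of x "x + 1", simplified]
    by eventually_elim (simp add: subgradient_le_slope(1)[OF sub])
  show "eventually (\<lambda>y. (f y - f x) / (y - x) \<le> S y) (at_right x)"
    using eventually_at_right_real[of x "x + 1", simplified]
    by eventually_elim (simp add: subgradient_le_slope(2)[OF sub])
qed

lemma left_deriv_le_right_deriv:
  fixes f :: "real \<Rightarrow> real"
  assumes f: "convex_on UNIV f" and D: "(f has_real_derivative D) (at_right x)"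
  shows "left_deriv f x \<le> D"
proof (rule tendsto_lowerbound)
  show "((\<lambda>y. (f y - f x) / (y - x)) \<longlongrightarrow> D) (at_right x)"
    using D by (simp add: has_field_derivative_iff)
  show "eventually (\<lambda>y. left_deriv f x \<le> (f y - f x) / (y - x)) (at_right x)"
    using eventually_at_right_real[of x "x + 1", simplified]
    by eventually_elim (simp add: subgradient_le_slope(1)[OF left_deriv_is_subgradient[OF f]])
qed simp

text \<open>
  The minimum criterion is one-sided on purpose: the subgradients available to the left of the
  minimizer \<open>q\<close> are those at nearby points \<open>s < q\<close>, from which continuity leads to \<open>q\<close>.
\<close>

lemma subgradient_sign_change_imp_minimum:
  assumes sub: "subgradient_of f S"
    and left: "\<And>s. s < q \<Longrightarrow> S s \<le> 0" and at: "0 \<le> S q"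
  shows "f q \<le> f x"
proof (cases "q \<le> x")
  case True
  then have "0 \<le> S q * (x - q)" using at by simp
  with subgradient_ofD[OF sub, of q x] show ?thesis by linarith
next
  case False
  then have "x < q" by simp
  have "isCont f q"
    using subgradient_imp_continuous[OF sub] by (simp add: continuous_on_eq_continuous_at)
  then have lim: "(f \<longlongrightarrow> f q) (at_left q)"
    by (auto simp: isCont_def intro: tendsto_within_subset)
  have "eventually (\<lambda>s. f s \<le> f x) (at_left q)"
    using eventually_at_left_real[OF \<open>x < q\<close>]
  proof eventually_elim
    case (elim s)
    then have "0 \<le> S s * (x - s)" using left[of s] by (intro mult_nonpos_nonpos) auto
    with subgradient_ofD[OF sub, of s x] show ?case by linarith
  qed
  then show ?thesis by (rule tendsto_upperbound[OF lim]) simp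
qed

section \<open>The loss and its tilted version\<close>

lemma loss_left_deriv:
  assumes "\<rho> \<in> loss_class"
  shows "subgradient_of \<rho> (left_deriv \<rho>)"
    and "mono (left_deriv \<rho>)"
    and "(left_deriv \<rho> \<longlongrightarrow> left_deriv \<rho> x) (at_left x)"
proof -
  have "convex_on UNIV \<rho>" using assms by (simp add: loss_class_def)
  then show "subgradient_of \<rho> (left_deriv \<rho>)"
    and "(left_deriv \<rho> \<longlongrightarrow> left_deriv \<rho> x) (at_left x)"
    by (rule left_deriv_is_subgradient left_deriv_left_continuous)+
  then show "mono (left_deriv \<rho>)" by (intro subgradient_mono)
qed

text \<open>
  With \<open>\<psi>\<close> the left derivative, the line of slope \<open>\<psi> t\<close> through \<open>(t, \<rho> t)\<close>, which starts at a
  positive height if \<open>t \<noteq> 0\<close>, does not pass above the origin; this fixes the sign of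
  \<open>\<psi> t\<close> for \<open>t \<noteq> 0\<close>. The sign at \<open>0\<close> comes from left-continuity; it can be strict, as for the
  absolute value.
\<close>

lemma loss_left_deriv_sign:
  assumes \<rho>: "\<rho> \<in> loss_class"
  shows "0 < t \<Longrightarrow> 0 < left_deriv \<rho> t"
    and "t < 0 \<Longrightarrow> left_deriv \<rho> t < 0"
    and "left_deriv \<rho> 0 \<le> 0"
proof -
  have pos: "0 < \<rho> t" if "t \<noteq> 0" for t
    using \<rho> that unfolding loss_class_def by (smt (verit) mem_Collect_eq)
  have zero: "\<rho> 0 = 0" using \<rho> by (simp add: loss_class_def)
  have key: "\<rho> t \<le> left_deriv \<rho> t * t" for t
    using subgradient_ofD[OF loss_left_deriv(1)[OF \<rho>], of t 0] zero by simp
  have neg: "left_deriv \<rho> t < 0" if "t < 0" for t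
    using key[of t] pos[of t] that
    by (smt (verit) mult_nonneg_nonpos)
  show "0 < t \<Longrightarrow> 0 < left_deriv \<rho> t"
    using key[of t] pos[of t] by (smt (verit) mult_nonpos_nonneg)
  show "t < 0 \<Longrightarrow> left_deriv \<rho> t < 0" by (rule neg)
  have "eventually (\<lambda>t. left_deriv \<rho> t \<le> 0) (at_left 0)"
    using eventually_at_left_real[of "-1" 0, simplified]
    by eventually_elim (simp add: neg less_imp_le)
  then show "left_deriv \<rho> 0 \<le> 0"
    by (rule tendsto_upperbound[OF loss_left_deriv(3)[OF \<rho>]]) simp
qed

text \<open>
  The case \<open>z = \<theta>\<close> counts towards the negative part, in agreement with \<open>left_deriv \<rho> 0 \<le> 0\<close>. This
  turns the indicator into a monotone function of \<open>left_deriv \<rho>\<close>, which preserves one-sided continuity.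
\<close>

lemma loss_left_deriv_parts:
  assumes \<rho>: "\<rho> \<in> loss_class"
  shows "\<bar>left_deriv \<rho> (z - \<theta>)\<bar> * of_bool (z \<le> \<theta>) = - min (left_deriv \<rho> (z - \<theta>)) 0"
  using loss_left_deriv_sign(1,2)[OF \<rho>, of "z - \<theta>"] loss_left_deriv_sign(3)[OF \<rho>]
  by (cases z \<theta> rule: linorder_cases) auto

text \<open>
  On either half-line the claim is the subgradient inequality of \<open>\<rho>\<close>, scaled. Across the origin the
  supporting line, which has dropped to a nonpositive value at \<open>0\<close>, does not rise again, whereas the loss is
  nonnegative.
\<close>

lemma tilted_is_subgradient:
  assumes \<rho>: "\<rho> \<in> loss_class" and \<alpha>: "0 \<le> \<alpha>" "\<alpha> \<le> 1"
  shows "subgradient_of (tilted \<rho> \<alpha>)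
           (\<lambda>t. (1 - \<alpha>) * min (left_deriv \<rho> t) 0 + \<alpha> * max (left_deriv \<rho> t) 0)"
  unfolding subgradient_of_def
proof (intro allI)
  fix t s :: real
  let ?\<psi> = "left_deriv \<rho>"
  have nonneg: "0 \<le> \<rho> u" for u using \<rho> by (simp add: loss_class_def)
  have zero: "\<rho> 0 = 0" using \<rho> by (simp add: loss_class_def)
  note sub = subgradient_ofD[OF loss_left_deriv(1)[OF \<rho>]]
  note sgn = loss_left_deriv_sign[OF \<rho>]
  have tilted_nonneg: "0 \<le> tilted \<rho> \<alpha> s" using nonneg \<alpha> by (simp add: tilted_def)
  show "tilted \<rho> \<alpha> t + ((1 - \<alpha>) * min (?\<psi> t) 0 + \<alpha> * max (?\<psi> t) 0) * (s - t) \<le> tilted \<rho> \<alpha> s"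
  proof (cases "0 < t")
    case True
    have L: "tilted \<rho> \<alpha> t + ((1 - \<alpha>) * min (?\<psi> t) 0 + \<alpha> * max (?\<psi> t) 0) * (s - t)
        = \<alpha> * (\<rho> t + ?\<psi> t * (s - t))"
      using True sgn(1)[of t] by (simp add: tilted_def algebra_simps)
    show ?thesis
    proof (cases "0 \<le> s")
      case True
      have "tilted \<rho> \<alpha> s = \<alpha> * \<rho> s" using True zero by (cases "s = 0") (auto simp: tilted_def)
      with L sub[of t s] \<alpha> show ?thesis by (simp add: mult_left_mono)
    next
      case False
      have "?\<psi> t * s \<le> 0" using False sgn(1)[of t] True by (intro mult_nonneg_nonpos) auto
      then have "\<rho> t + ?\<psi> t * (s - t) \<le> 0"
        using sub[of t 0] zero by (simp add: algebra_simps)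
      with L \<alpha> tilted_nonneg show ?thesis by (smt (verit) mult_nonneg_nonpos)
    qed
  next
    case False
    have \<psi>: "?\<psi> t \<le> 0" using False sgn(2)[of t] sgn(3) by (cases "t = 0") auto
    have "tilted \<rho> \<alpha> t = (1 - \<alpha>) * \<rho> t" using False zero by (cases "t = 0") (auto simp: tilted_def)
    then have L: "tilted \<rho> \<alpha> t + ((1 - \<alpha>) * min (?\<psi> t) 0 + \<alpha> * max (?\<psi> t) 0) * (s - t)
        = (1 - \<alpha>) * (\<rho> t + ?\<psi> t * (s - t))"
      using \<psi> by (simp add: algebra_simps)
    show ?thesis
    proof (cases "s \<le> 0")
      case True
      have "tilted \<rho> \<alpha> s = (1 - \<alpha>) * \<rho> s" using True zero by (cases "s = 0") (auto simp: tilted_def)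
      with L sub[of t s] \<alpha> show ?thesis by (simp add: mult_left_mono)
    next
      case False
      have "?\<psi> t * s \<le> 0" using False \<psi> by (intro mult_nonpos_nonneg) auto
      then have "\<rho> t + ?\<psi> t * (s - t) \<le> 0"
        using sub[of t 0] zero by (simp add: algebra_simps)
      with L \<alpha> tilted_nonneg show ?thesis by (smt (verit) mult_nonneg_nonpos)
    qed
  qed
qed

section \<open>Expectations of translates\<close>

lemma expected_loss_is_subgradient:
  fixes h S :: "real \<Rightarrow> real" and Z :: "'w \<Rightarrow> real"
  assumes sub: "subgradient_of h S" and Z[measurable]: "Z \<in> borel_measurable M"
    and int: "\<And>\<theta>. integrable M (\<lambda>\<omega>. S (Z \<omega> - \<theta>))"
  shows "integrable M (\<lambda>\<omega>. h (Z \<omega> - \<theta>) - h (Z \<omega>))" (is "?integrable \<theta>")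
    and "subgradient_of (\<lambda>\<theta>. \<integral>\<omega>. h (Z \<omega> - \<theta>) - h (Z \<omega>) \<partial>M) (\<lambda>\<theta>. - (\<integral>\<omega>. S (Z \<omega> - \<theta>) \<partial>M))"
proof -
  have [measurable]: "h \<in> borel_measurable borel"
    using subgradient_imp_continuous[OF sub] by (rule borel_measurable_continuous_onI)
  \<comment> \<open>An increment of \<open>h\<close> is controlled by the subgradients at the two end points.\<close>
  have incr: "\<bar>h b - h a\<bar> \<le> \<bar>b - a\<bar> * (\<bar>S a\<bar> + \<bar>S b\<bar>)" for a b
  proof -
    have "\<bar>h b - h a\<bar> \<le> \<bar>S a * (b - a)\<bar> + \<bar>S b * (a - b)\<bar>"
      using subgradient_ofD[OF sub, of a b] subgradient_ofD[OF sub, of b a] by linarith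
    also have "\<dots> = \<bar>b - a\<bar> * (\<bar>S a\<bar> + \<bar>S b\<bar>)"
      by (simp only: abs_mult abs_minus_commute[of a b]) (simp add: algebra_simps)
    finally show ?thesis .
  qed
  show 1: "?integrable \<theta>" for \<theta>
  proof (rule Bochner_Integration.integrable_bound)
    show "integrable M (\<lambda>\<omega>. \<bar>\<theta>\<bar> * (\<bar>S (Z \<omega> - 0)\<bar> + \<bar>S (Z \<omega> - \<theta>)\<bar>))"
      using int by (intro integrable_mult_right Bochner_Integration.integrable_add integrable_abs)
    show "AE \<omega> in M. norm (h (Z \<omega> - \<theta>) - h (Z \<omega>))
                     \<le> norm (\<bar>\<theta>\<bar> * (\<bar>S (Z \<omega> - 0)\<bar> + \<bar>S (Z \<omega> - \<theta>)\<bar>))"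
    proof (rule AE_I2)
      fix \<omega>
      show "norm (h (Z \<omega> - \<theta>) - h (Z \<omega>))
            \<le> norm (\<bar>\<theta>\<bar> * (\<bar>S (Z \<omega> - 0)\<bar> + \<bar>S (Z \<omega> - \<theta>)\<bar>))"
        using incr[of "Z \<omega> - \<theta>" "Z \<omega>"] by (simp add: abs_mult)
    qed
  qed measurable
  show "subgradient_of (\<lambda>\<theta>. \<integral>\<omega>. h (Z \<omega> - \<theta>) - h (Z \<omega>) \<partial>M) (\<lambda>\<theta>. - (\<integral>\<omega>. S (Z \<omega> - \<theta>) \<partial>M))"
    unfolding subgradient_of_def
  proof (intro allI)
    fix x y
    have "(\<integral>\<omega>. h (Z \<omega> - x) - h (Z \<omega>) \<partial>M) + - (\<integral>\<omega>. S (Z \<omega> - x) \<partial>M) * (y - x)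
        = (\<integral>\<omega>. (h (Z \<omega> - x) - h (Z \<omega>)) + S (Z \<omega> - x) * (x - y) \<partial>M)"
      by (subst Bochner_Integration.integral_add) (use 1 int in \<open>auto simp: algebra_simps\<close>)
    also have "\<dots> \<le> (\<integral>\<omega>. h (Z \<omega> - y) - h (Z \<omega>) \<partial>M)"
    proof (rule integral_mono)
      fix \<omega>
      show "h (Z \<omega> - x) - h (Z \<omega>) + S (Z \<omega> - x) * (x - y) \<le> h (Z \<omega> - y) - h (Z \<omega>)"
        using subgradient_ofD[OF sub, of "Z \<omega> - x" "Z \<omega> - y"] by simp
    qed (use 1 int in auto)
    finally show "(\<integral>\<omega>. h (Z \<omega> - x) - h (Z \<omega>) \<partial>M) + - (\<integral>\<omega>. S (Z \<omega> - x) \<partial>M) * (y - x)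
        \<le> (\<integral>\<omega>. h (Z \<omega> - y) - h (Z \<omega>) \<partial>M)" .
  qed
qed

text \<open>
  Monotonicity is what makes dominated convergence applicable: for \<open>\<bar>s - \<theta>\<bar> \<le> 1\<close> the value
  \<open>\<phi> (Z - s)\<close> lies between \<open>\<phi> (Z - \<theta> - 1)\<close> and \<open>\<phi> (Z - \<theta> + 1)\<close>, both integrable. The set \<open>T\<close> allows
  for one-sided continuity.
\<close>

lemma expected_translate_continuous:
  fixes \<phi> :: "real \<Rightarrow> real" and Z :: "'w \<Rightarrow> real"
  assumes mono: "mono \<phi>" and int: "\<And>\<theta>. integrable M (\<lambda>\<omega>. \<phi> (Z \<omega> - \<theta>))"
    and cont: "AE \<omega> in M. continuous (at \<theta> within T) (\<lambda>s. \<phi> (Z \<omega> - s))"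
  shows "continuous (at \<theta> within T) (\<lambda>s. \<integral>\<omega>. \<phi> (Z \<omega> - s) \<partial>M)"
proof (rule continuous_within_sequentiallyI)
  fix u :: "nat \<Rightarrow> real" assume u: "u \<longlonglongrightarrow> \<theta>" and uT: "\<forall>n. u n \<in> T"
  obtain N where N: "\<And>n. N \<le> n \<Longrightarrow> dist (u n) \<theta> < 1"
    using u by (metis LIMSEQ_def zero_less_one)
  show "(\<lambda>n. \<integral>\<omega>. \<phi> (Z \<omega> - u n) \<partial>M) \<longlonglongrightarrow> (\<integral>\<omega>. \<phi> (Z \<omega> - \<theta>) \<partial>M)"
  proof (rule LIMSEQ_offset[of _ N], rule integral_dominated_convergence)
    show "integrable M (\<lambda>\<omega>. \<bar>\<phi> (Z \<omega> - (\<theta> + 1))\<bar> + \<bar>\<phi> (Z \<omega> - (\<theta> - 1))\<bar>)"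
      using int by (intro Bochner_Integration.integrable_add integrable_abs)
    show "AE \<omega> in M. (\<lambda>n. \<phi> (Z \<omega> - u (n + N))) \<longlonglongrightarrow> \<phi> (Z \<omega> - \<theta>)"
      using cont
    proof eventually_elim
      case (elim \<omega>)
      have "(\<lambda>n. u (n + N)) \<longlonglongrightarrow> \<theta>" using u by (rule LIMSEQ_ignore_initial_segment)
      with elim uT show ?case by (auto simp: continuous_within_sequentially o_def)
    qed
    show "AE \<omega> in M. norm (\<phi> (Z \<omega> - u (n + N)))
                     \<le> \<bar>\<phi> (Z \<omega> - (\<theta> + 1))\<bar> + \<bar>\<phi> (Z \<omega> - (\<theta> - 1))\<bar>" for n
    proof (rule AE_I2)
      fix \<omega>
      have "\<bar>u (n + N) - \<theta>\<bar> < 1" using N[of "n + N"] by (simp add: dist_real_def)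
      then show "norm (\<phi> (Z \<omega> - u (n + N)))
                 \<le> \<bar>\<phi> (Z \<omega> - (\<theta> + 1))\<bar> + \<bar>\<phi> (Z \<omega> - (\<theta> - 1))\<bar>"
        using monoD[OF mono, of "Z \<omega> - (\<theta> + 1)" "Z \<omega> - u (n + N)"]
          monoD[OF mono, of "Z \<omega> - u (n + N)" "Z \<omega> - (\<theta> - 1)"] by fastforce
    qed
  qed (use int in \<open>auto intro: borel_measurable_integrable\<close>)
qed

text \<open>Moving the threshold \<open>\<theta>\<close> to the right is moving the argument \<open>z - \<theta>\<close> to the left.\<close>

lemma right_continuous_reflected_translate:
  fixes \<phi> :: "real \<Rightarrow> real"
  assumes "(\<phi> \<longlongrightarrow> \<phi> (z - \<theta>)) (at_left (z - \<theta>))"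
  shows "continuous (at_right \<theta>) (\<lambda>s. \<phi> (z - s))"
proof -
  have "((\<lambda>s. z - s) \<longlongrightarrow> z - \<theta>) (at_right \<theta>)" by (intro tendsto_intros)
  moreover have "eventually (\<lambda>s. z - s \<in> {..<z - \<theta>} \<and> z - s \<noteq> z - \<theta>) (at_right \<theta>)"
    using eventually_at_right_real[of \<theta> "\<theta> + 1", simplified] by eventually_elim simp
  ultimately have "filterlim (\<lambda>s. z - s) (at_left (z - \<theta>)) (at_right \<theta>)"
    by (simp add: filterlim_at)
  from filterlim_compose[OF assms this] show ?thesis by (simp add: continuous_within)
qed

lemma expected_translate_tendsto_0:
  fixes \<phi> :: "real \<Rightarrow> real" and Z :: "'w \<Rightarrow> real"
  assumes mono: "mono \<phi>" and zero: "\<And>t. t < 0 \<Longrightarrow> \<phi> t = 0" and nonneg: "\<And>t. 0 \<le> \<phi> t"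
    and int: "\<And>\<theta>. integrable M (\<lambda>\<omega>. \<phi> (Z \<omega> - \<theta>))"
  shows "((\<lambda>\<theta>. \<integral>\<omega>. \<phi> (Z \<omega> - \<theta>) \<partial>M) \<longlongrightarrow> 0) at_top"
proof -
  have "((\<lambda>\<theta>. \<integral>\<omega>. \<phi> (Z \<omega> - \<theta>) \<partial>M) \<longlongrightarrow> (\<integral>\<omega>. 0 \<partial>M)) at_top"
  proof (rule integral_dominated_convergence_at_top)
    show "integrable M (\<lambda>\<omega>. \<phi> (Z \<omega> - 0))" by (rule int)
    show "AE \<omega> in M. ((\<lambda>\<theta>. \<phi> (Z \<omega> - \<theta>)) \<longlongrightarrow> 0) at_top"
    proof (rule AE_I2)
      fix \<omega>
      have "eventually (\<lambda>\<theta>. \<phi> (Z \<omega> - \<theta>) = 0) at_top"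
        using eventually_gt_at_top[of "Z \<omega>"] by eventually_elim (simp add: zero)
      then show "((\<lambda>\<theta>. \<phi> (Z \<omega> - \<theta>)) \<longlongrightarrow> 0) at_top" by (rule tendsto_eventually)
    qed
    show "eventually (\<lambda>\<theta>. AE \<omega> in M. norm (\<phi> (Z \<omega> - \<theta>)) \<le> \<phi> (Z \<omega> - 0)) at_top"
      using eventually_ge_at_top[of 0]
      by eventually_elim (auto simp: nonneg intro!: monoD[OF mono])
  qed (use int in \<open>auto intro: borel_measurable_integrable\<close>)
  then show ?thesis by simp
qed

text \<open>If all these expectations vanished, \<open>Z\<close> would almost surely lie below every integer.\<close>

lemma (in prob_space) expected_translate_pos:
  fixes \<phi> :: "real \<Rightarrow> real" and Z :: "'a \<Rightarrow> real"
  assumes pos: "\<And>t. 0 < t \<Longrightarrow> 0 < \<phi> t" and nonneg: "\<And>t. 0 \<le> \<phi> t"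
    and int: "\<And>\<theta>. integrable M (\<lambda>\<omega>. \<phi> (Z \<omega> - \<theta>))"
  shows "\<exists>\<theta>. 0 < (\<integral>\<omega>. \<phi> (Z \<omega> - \<theta>) \<partial>M)"
proof (rule ccontr)
  assume "\<not> ?thesis"
  then have "(\<integral>\<omega>. \<phi> (Z \<omega> - \<theta>) \<partial>M) = 0" for \<theta>
    using Bochner_Integration.integral_nonneg[of M "\<lambda>\<omega>. \<phi> (Z \<omega> - \<theta>)"] nonneg
    by (metis order_le_less)
  then have "AE \<omega> in M. \<phi> (Z \<omega> - \<theta>) = 0" for \<theta>
    using integral_nonneg_eq_0_iff_AE[OF int] nonneg by simp
  then have "AE \<omega> in M. \<forall>n::nat. \<phi> (Z \<omega> - (- real n)) = 0"
    unfolding AE_all_countable by blast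
  then have "AE \<omega> in M. False"
  proof eventually_elim
    case (elim \<omega>)
    obtain n :: nat where "- Z \<omega> < real n" using reals_Archimedean2 by blast
    then have "0 < \<phi> (Z \<omega> - (- real n))" by (intro pos) simp
    with elim show ?case by simp
  qed
  then show False by simp
qed

section \<open>Distribution functions and quantiles\<close>

text \<open>
  Monotonicity is \<open>A x * B y \<le> A y * B x\<close>. In the tails the denominator is at least \<open>B b\<close>, respectively
  \<open>A a\<close>, so the numerators \<open>A\<close> of the ratio and \<open>B\<close> of its complement determine the limits.
\<close>

lemma ratio_is_cdf:
  fixes A B :: "real \<Rightarrow> real"
  assumes A: "mono A" "\<And>x. 0 \<le> A x" "\<And>x. continuous (at_right x) A" "(A \<longlongrightarrow> 0) at_bot" "0 < A a"
    and B: "antimono B" "\<And>x. 0 \<le> B x" "\<And>x. continuous (at_right x) B" "(B \<longlongrightarrow> 0) at_top" "0 < B b"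
    and pos: "\<And>x. 0 < A x + B x"
  shows "\<exists>Q. real_distribution Q \<and> (\<lambda>x. A x / (A x + B x)) = cdf Q"
proof -
  let ?G = "\<lambda>x. A x / (A x + B x)"
  have mono: "?G x \<le> ?G y" if "x \<le> y" for x y
  proof -
    have "A x * B y \<le> A y * B x"
      using monoD[OF A(1) that] antimonoD[OF B(1) that] A(2) B(2) by (intro mult_mono) auto
    then show ?thesis using pos[of x] pos[of y] by (simp add: field_simps)
  qed
  have cont: "continuous (at_right x) ?G" for x
    using A(3)[of x] B(3)[of x] pos[of x]
    unfolding continuous_within by (intro tendsto_intros) auto
  have bot: "(?G \<longlongrightarrow> 0) at_bot"
  proof (rule tendsto_sandwich[OF _ _ tendsto_const])
    show "eventually (\<lambda>x. 0 \<le> ?G x) at_bot" using A(2) B(2) by simp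
    show "eventually (\<lambda>x. ?G x \<le> A x / B b) at_bot"
      using eventually_le_at_bot[of b]
    proof eventually_elim
      case (elim x)
      then show ?case
        using antimonoD[OF B(1) elim] B(5) A(2)[of x] by (intro divide_left_mono) auto
    qed
    show "((\<lambda>x. A x / B b) \<longlongrightarrow> 0) at_bot" using tendsto_divide[OF A(4) tendsto_const] B(5) by force
  qed
  have "((\<lambda>x. 1 - ?G x) \<longlongrightarrow> 0) at_top"
  proof (rule tendsto_sandwich[OF _ _ tendsto_const])
    have eq: "1 - ?G x = B x / (A x + B x)" for x using pos[of x] by (simp add: field_simps)
    show "eventually (\<lambda>x. 0 \<le> 1 - ?G x) at_top" using A(2) B(2) by (simp add: eq)
    show "eventually (\<lambda>x. 1 - ?G x \<le> B x / A a) at_top"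
      using eventually_ge_at_top[of a]
    proof eventually_elim
      case (elim x)
      then show ?case unfolding eq
        using monoD[OF A(1) elim] A(5) B(2)[of x] by (intro divide_left_mono) auto
    qed
    show "((\<lambda>x. B x / A a) \<longlongrightarrow> 0) at_top" using tendsto_divide[OF B(4) tendsto_const] A(5) by force
  qed
  from tendsto_diff[OF tendsto_const[of 1] this] have top: "(?G \<longlongrightarrow> 1) at_top" by simp
  show ?thesis
    using real_distribution_interval_measure[of ?G, OF mono cont bot top]
      cdf_interval_measure[of ?G, OF mono cont bot] by metis
qed

text \<open>
  The limits at both ends make the infimum one of a nonempty set that is bounded below, and
  right-continuity makes it attained.
\<close>

lemma cdf_quantile:
  assumes Q: "real_distribution Q" and \<alpha>: "0 < \<alpha>" "\<alpha> < 1"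
  defines "q \<equiv> Inf {x. \<alpha> \<le> cdf Q x}"
  shows "\<alpha> \<le> cdf Q q" and "x < q \<Longrightarrow> cdf Q x < \<alpha>"
proof -
  interpret real_distribution Q by fact
  let ?S = "{x. \<alpha> \<le> cdf Q x}"
  have "eventually (\<lambda>x. \<alpha> < cdf Q x) at_top"
    by (rule order_tendstoD(1)[OF cdf_lim_at_top_prob \<alpha>(2)])
  then obtain t where "\<alpha> < cdf Q t" using eventually_happens'[OF trivial_limit_at_top_linorder] by blast
  then have ne: "?S \<noteq> {}" by (auto intro: less_imp_le)
  have "eventually (\<lambda>x. cdf Q x < \<alpha>) at_bot"
    by (rule order_tendstoD(2)[OF cdf_lim_at_bot \<alpha>(1)])
  then obtain l where l: "cdf Q l < \<alpha>" using eventually_happens'[OF trivial_limit_at_bot_linorder] by blast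
  have bdd: "bdd_below ?S"
  proof (rule bdd_belowI)
    fix x assume "x \<in> ?S"
    then show "l \<le> x" using cdf_nondecreasing[of x l] l by (cases "l \<le> x") auto
  qed
  show below: "x < q \<Longrightarrow> cdf Q x < \<alpha>" for x
    using cInf_lower[OF _ bdd, of x] by (force simp: q_def)
  have "eventually (\<lambda>x. \<alpha> \<le> cdf Q x) (at_right q)"
    using eventually_at_right_real[of q "q + 1", simplified]
  proof eventually_elim
    case (elim x)
    then obtain y where "\<alpha> \<le> cdf Q y" "y < x"
      using cInf_less_iff[OF ne bdd, of x] by (auto simp: q_def)
    then show ?case using cdf_nondecreasing[of y x] by simp
  qed
  moreover have "(cdf Q \<longlongrightarrow> cdf Q q) (at_right q)"
    using cdf_is_right_cont[of q] by (simp add: continuous_within)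
  ultimately show "\<alpha> \<le> cdf Q q" by (intro tendsto_lowerbound) auto
qed

lemma nonatomic_AE_notin_countable:
  assumes Z[measurable]: "Z \<in> borel_measurable M"
    and atom: "\<And>x::real. emeasure (distr M borel Z) {x} = 0" and C: "countable C"
  shows "AE \<omega> in M. Z \<omega> \<notin> C"
proof -
  have [measurable]: "C \<in> sets borel"
    using C by (rule sets.countable[rotated]) simp
  have [measurable]: "C \<in> sets borel"
    using C by (rule sets.countable[rotated]) simp
  have [measurable]: "C \<in> sets borel"
    using C by (rule sets.countable[rotated]) simp
  have [measurable]: "C \<in> sets borel"
    using C by (rule sets.countable[rotated]) simp
  have [measurable]: "C \<in> sets borel"
    using C by (rule sets.countable[rotated]) simp
  have [measurable]: "C \<in> sets borel"
    using C by (rule sets.countable[rotated]) simp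
  have [measurable]: "C \<in> sets borel"
    using C by (rule sets.countable[rotated]) simp
  have [measurable]: "C \<in> sets borel"
    using C by (rule sets.countable[rotated]) simp
  have [measurable]: "C \<in> sets borel"
    using C by (rule sets.countable[rotated]) simp
  have [measurable]: "C \<in> sets borel"
    using C by (rule sets.countable[rotated]) simp
  have "(\<Union>x\<in>C. {x}) \<in> null_sets (distr M borel Z)"
    using C atom by (intro null_sets_UN') auto
  then have "AE z in distr M borel Z. z \<notin> C" by (auto dest: AE_not_in)
  then show ?thesis by (subst (asm) AE_distr_iff) simp_all
qed

section \<open>The objective and its minimizer\<close>

theorem theorem2p1:
  fixes \<alpha> :: real and \<rho> :: "real \<Rightarrow> real" and P :: "real measure"
    and M :: "'w measure" and Z :: "'w \<Rightarrow> real"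
  assumes "0 < \<alpha>" and "\<alpha> < 1"
    and "\<rho> \<in> loss_class"
    and "P \<in> prob_class \<rho>"
    and "prob_space M" and "Z \<in> borel_measurable M" and "distr M borel Z = P"
  shows
    "((\<forall>\<theta>. integrable M (\<lambda>\<omega>. tilted \<rho> \<alpha> (Z \<omega> - \<theta>) - tilted \<rho> \<alpha> (Z \<omega>))) \<and>
      (\<forall>\<theta>. M_objective \<rho> \<alpha> M Z differentiable (at_left \<theta>) \<and>
           M_objective \<rho> \<alpha> M Z differentiable (at_right \<theta>)) \<and>
      continuous_on UNIV (M_objective \<rho> \<alpha> M Z)) \<and>
     (\<forall>\<theta>. left_deriv (M_objective \<rho> \<alpha> M Z) \<theta> \<le> right_deriv (M_objective \<rho> \<alpha> M Z) \<theta>) \<and>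
     (\<forall>\<theta>. sgn (right_deriv (M_objective \<rho> \<alpha> M Z) \<theta>) = sgn (M_cdf \<rho> M Z \<theta> - \<alpha>)) \<and>
     (\<exists>Q. real_distribution Q \<and> M_cdf \<rho> M Z = cdf Q) \<and>
     (\<forall>\<theta>. M_objective \<rho> \<alpha> M Z (M_quantile \<rho> \<alpha> P) \<le> M_objective \<rho> \<alpha> M Z \<theta>) \<and>
     (continuous_on UNIV (left_deriv \<rho>) \<or> (\<forall>x. measure P {x} = 0) \<longrightarrow>
        isCont (M_cdf \<rho> M Z) (M_quantile \<rho> \<alpha> P) \<and>
        M_cdf \<rho> M Z (M_quantile \<rho> \<alpha> P) = \<alpha>)"
proof -
  note \<alpha> = \<open>0 < \<alpha>\<close> \<open>\<alpha> < 1\<close> and \<rho> = \<open>\<rho> \<in> loss_class\<close> and Z[measurable] = \<open>Z \<in> borel_measurable M\<close>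
  interpret prob_space M by fact
  let ?\<psi> = "left_deriv \<rho>"
  note mono_\<psi> = loss_left_deriv(2)[OF \<rho>] and sgn_\<psi> = loss_left_deriv_sign[OF \<rho>]
  have \<psi>_pos_part: "t \<le> 0 \<Longrightarrow> max (?\<psi> t) 0 = 0" and \<psi>_neg_part: "0 < t \<Longrightarrow> min (?\<psi> t) 0 = 0" for t
    using sgn_\<psi>(1)[of t] sgn_\<psi>(2)[of t] sgn_\<psi>(3) by (cases "t = 0"; force)+
  have meas_borel: "(\<lambda>z. ?\<psi> (z - \<theta>)) \<in> borel_measurable borel" for \<theta>
    by (rule measurable_compose[OF _ borel_measurable_mono[OF mono_\<psi>]]) simp
  have meas_M: "(\<lambda>\<omega>. ?\<psi> (Z \<omega> - \<theta>)) \<in> borel_measurable M" for \<theta>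
    by (rule measurable_compose[OF Z meas_borel])
  have P: "P = distr M borel Z" using \<open>distr M borel Z = P\<close> by simp
  have int_abs: "integrable M (\<lambda>\<omega>. \<bar>?\<psi> (Z \<omega> - \<theta>)\<bar>)" for \<theta>
    by (rule integrable_distr[OF Z]) (use \<open>P \<in> prob_class \<rho>\<close> in \<open>simp add: prob_class_def P\<close>)
  have int_\<psi>: "integrable M (\<lambda>\<omega>. ?\<psi> (Z \<omega> - \<theta>))" for \<theta>
    by (rule integrable_abs_cancel[OF int_abs meas_M])
  have int_min: "integrable M (\<lambda>\<omega>. min (?\<psi> (Z \<omega> - \<theta>)) 0)"
    and int_max: "integrable M (\<lambda>\<omega>. max (?\<psi> (Z \<omega> - \<theta>)) 0)" for \<theta>
    using int_\<psi> by auto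
  have mono_min: "mono (\<lambda>t. min (?\<psi> t) 0)" and mono_max: "mono (\<lambda>t. max (?\<psi> t) 0)"
    using mono_\<psi> unfolding mono_def by (meson min.mono max.mono order_refl)+

  define A where "A \<theta> = - (\<integral>\<omega>. min (?\<psi> (Z \<omega> - \<theta>)) 0 \<partial>M)" for \<theta>
  define B where "B \<theta> = (\<integral>\<omega>. max (?\<psi> (Z \<omega> - \<theta>)) 0 \<partial>M)" for \<theta>
  let ?G = "M_cdf \<rho> M Z"
  let ?O = "M_objective \<rho> \<alpha> M Z"
  let ?D = "\<lambda>\<theta>. (1 - \<alpha>) * A \<theta> - \<alpha> * B \<theta>"

  have AB: "(\<integral>\<omega>. \<bar>?\<psi> (Z \<omega> - \<theta>)\<bar> \<partial>M) = A \<theta> + B \<theta>" for \<theta>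
  proof -
    have "(\<integral>\<omega>. \<bar>?\<psi> (Z \<omega> - \<theta>)\<bar> \<partial>M) = (\<integral>\<omega>. max (?\<psi> (Z \<omega> - \<theta>)) 0 - min (?\<psi> (Z \<omega> - \<theta>)) 0 \<partial>M)"
      by (intro Bochner_Integration.integral_cong) auto
    then show ?thesis
      using int_min int_max by (simp add: A_def B_def)
  qed
  have G: "?G = (\<lambda>\<theta>. A \<theta> / (A \<theta> + B \<theta>))"
    by (simp add: fun_eq_iff M_cdf_def AB loss_left_deriv_parts[OF \<rho>]) (simp add: A_def)
  have A_nonneg: "0 \<le> A \<theta>" for \<theta>
    unfolding A_def using Bochner_Integration.integral_nonneg[of M "\<lambda>\<omega>. - min (?\<psi> (Z \<omega> - \<theta>)) 0"] by simp
  have B_nonneg: "0 \<le> B \<theta>" for \<theta>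
    unfolding B_def by simp

  \<comment> \<open>The denominator could vanish only if \<open>Z = \<theta>\<close> almost surely.\<close>
  have AB_pos: "0 < A \<theta> + B \<theta>" for \<theta>
  proof (rule ccontr)
    assume "\<not> 0 < A \<theta> + B \<theta>"
    then have "(\<integral>\<omega>. \<bar>?\<psi> (Z \<omega> - \<theta>)\<bar> \<partial>M) = 0"
      using A_nonneg[of \<theta>] B_nonneg[of \<theta>] by (simp add: AB)
    then have "AE \<omega> in M. ?\<psi> (Z \<omega> - \<theta>) = 0"
      using integral_nonneg_eq_0_iff_AE[OF int_abs] by simp
    then have "AE \<omega> in M. Z \<omega> \<in> {\<theta>}"
    proof eventually_elim
      case (elim \<omega>)
      then show ?case
        using sgn_\<psi>(1)[of "Z \<omega> - \<theta>"] sgn_\<psi>(2)[of "Z \<omega> - \<theta>"]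
        by (cases "Z \<omega>" \<theta> rule: linorder_cases) auto
    qed
    then have "prob (Z -` {\<theta>} \<inter> space M) = 1"
      by (intro prob_eq_1[THEN iffD2]) auto
    moreover have "measure P {\<theta>} < 1"
      using \<open>P \<in> prob_class \<rho>\<close> by (simp add: prob_class_def)
    ultimately show False by (simp add: P measure_distr)
  qed

  have continuous_AB: "continuous (at \<theta> within T) A" "continuous (at \<theta> within T) B"
    if "AE \<omega> in M. continuous (at \<theta> within T) (\<lambda>s. ?\<psi> (Z \<omega> - s))" for \<theta> T
  proof -
    have "AE \<omega> in M. continuous (at \<theta> within T) (\<lambda>s. min (?\<psi> (Z \<omega> - s)) 0)"
      using that by eventually_elim (intro continuous_intros)
    from expected_translate_continuous[OF mono_min int_min this]
    show "continuous (at \<theta> within T) A"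
      unfolding A_def[abs_def] by (intro continuous_intros)
    have "AE \<omega> in M. continuous (at \<theta> within T) (\<lambda>s. max (?\<psi> (Z \<omega> - s)) 0)"
      using that by eventually_elim (intro continuous_intros)
    from expected_translate_continuous[OF mono_max int_max this]
    show "continuous (at \<theta> within T) B"
      unfolding B_def[abs_def] .
  qed
  have right_cont: "continuous (at_right \<theta>) A" "continuous (at_right \<theta>) B" for \<theta>
    by (intro continuous_AB AE_I2 right_continuous_reflected_translate loss_left_deriv(3)[OF \<rho>])+

  have O_sub: "subgradient_of ?O ?D"
    and O_int: "\<And>\<theta>. integrable M (\<lambda>\<omega>. tilted \<rho> \<alpha> (Z \<omega> - \<theta>) - tilted \<rho> \<alpha> (Z \<omega>))"
  proof -
    have sub: "subgradient_of (tilted \<rho> \<alpha>)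
                 (\<lambda>t. (1 - \<alpha>) * min (?\<psi> t) 0 + \<alpha> * max (?\<psi> t) 0)"
      using tilted_is_subgradient[OF \<rho>] \<alpha> by simp
    have int: "integrable M (\<lambda>\<omega>. (1 - \<alpha>) * min (?\<psi> (Z \<omega> - \<theta>)) 0 + \<alpha> * max (?\<psi> (Z \<omega> - \<theta>)) 0)" for \<theta>
      using int_min int_max by simp
    show "\<And>\<theta>. integrable M (\<lambda>\<omega>. tilted \<rho> \<alpha> (Z \<omega> - \<theta>) - tilted \<rho> \<alpha> (Z \<omega>))"
      by (rule expected_loss_is_subgradient(1)[OF sub Z int])
    have "(\<lambda>\<theta>. - (\<integral>\<omega>. (1 - \<alpha>) * min (?\<psi> (Z \<omega> - \<theta>)) 0 + \<alpha> * max (?\<psi> (Z \<omega> - \<theta>)) 0 \<partial>M)) = ?D"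
      using int_min int_max by (simp add: A_def B_def fun_eq_iff)
    with expected_loss_is_subgradient(2)[OF sub Z int] show "subgradient_of ?O ?D"
      by (simp add: M_objective_def[abs_def])
  qed
  have O_convex: "convex_on UNIV ?O" by (rule subgradient_imp_convex[OF O_sub])
  have O_right: "(?O has_real_derivative ?D \<theta>) (at_right \<theta>)" for \<theta>
    using right_cont[of \<theta>] unfolding continuous_within
    by (intro right_continuous_subgradient_is_right_deriv[OF O_sub] tendsto_intros)
  have O_right_deriv: "right_deriv ?O \<theta> = ?D \<theta>" for \<theta>
    by (rule right_deriv_eqI[OF O_right])
  have D_G: "?D \<theta> = (A \<theta> + B \<theta>) * (?G \<theta> - \<alpha>)" for \<theta>
    using AB_pos[of \<theta>] by (simp add: G field_simps)

  have G_cdf: "\<exists>Q. real_distribution Q \<and> ?G = cdf Q"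
  proof -
    have "mono A"
    proof (rule monoI)
      fix x y :: real assume "x \<le> y"
      then show "A x \<le> A y"
        unfolding A_def neg_le_iff_le
        by (intro integral_mono int_min monoD[OF mono_min]) simp
    qed
    moreover have "antimono B"
    proof (rule antimonoI)
      fix x y :: real assume "x \<le> y"
      then show "B y \<le> B x"
        unfolding B_def by (intro integral_mono int_max monoD[OF mono_max]) simp
    qed
    \<comment> \<open>\<open>A\<close> behaves at the left end as \<open>B\<close> does at the right end: reflect \<open>Z\<close> and \<open>\<theta>\<close>.\<close>
    moreover
    let ?\<phi> = "\<lambda>t. - min (?\<psi> (- t)) 0"
    have A_reflect: "A \<theta> = (\<integral>\<omega>. ?\<phi> (- Z \<omega> - (- \<theta>)) \<partial>M)" for \<theta>
      by (simp add: A_def)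
    have int_\<phi>: "integrable M (\<lambda>\<omega>. ?\<phi> (- Z \<omega> - \<theta>))" for \<theta>
      using int_min[of "- \<theta>"] by (simp add: add.commute)
    have mono_\<phi>: "mono ?\<phi>"
      using mono_min by (simp add: mono_def)
    have "((\<lambda>\<theta>. \<integral>\<omega>. ?\<phi> (- Z \<omega> - \<theta>) \<partial>M) \<longlongrightarrow> 0) at_top"
      by (rule expected_translate_tendsto_0[OF mono_\<phi> _ _ int_\<phi>]) (simp_all add: \<psi>_neg_part)
    then have "(A \<longlongrightarrow> 0) at_bot"
      unfolding A_reflect[abs_def] by (simp add: filterlim_at_bot_mirror add.commute)
    moreover have "(B \<longlongrightarrow> 0) at_top"
      unfolding B_def[abs_def]
      by (rule expected_translate_tendsto_0[OF mono_max _ _ int_max]) (simp_all add: \<psi>_pos_part)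
    moreover have "\<exists>\<theta>. 0 < (\<integral>\<omega>. ?\<phi> (- Z \<omega> - \<theta>) \<partial>M)"
      by (rule expected_translate_pos[OF _ _ int_\<phi>]) (use sgn_\<psi>(2) in auto)
    then obtain a where "0 < A (- a)" by (auto simp: A_reflect)
    moreover have "\<exists>\<theta>. 0 < (\<integral>\<omega>. max (?\<psi> (Z \<omega> - \<theta>)) 0 \<partial>M)"
      by (rule expected_translate_pos[OF _ _ int_max]) (use sgn_\<psi>(1) in auto)
    then obtain b where "0 < B b" by (auto simp: B_def)
    ultimately show ?thesis
      unfolding G using ratio_is_cdf[of A "- a" B b] A_nonneg B_nonneg right_cont AB_pos by blast
  qed

  have "M_cdf \<rho> P (\<lambda>z. z) = ?G"
  proof
    fix \<theta>
    have "(\<lambda>z. - min (?\<psi> (z - \<theta>)) 0) \<in> borel_measurable borel"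
      and "(\<lambda>z. \<bar>?\<psi> (z - \<theta>)\<bar>) \<in> borel_measurable borel"
      by (intro borel_measurable_uminus borel_measurable_min borel_measurable_abs
            borel_measurable_const meas_borel)+
    from this[THEN integral_distr[OF Z]] show "M_cdf \<rho> P (\<lambda>z. z) \<theta> = ?G \<theta>"
      unfolding M_cdf_def P loss_left_deriv_parts[OF \<rho>] by (simp only:)
  qed
  then have quantile: "M_quantile \<rho> \<alpha> P = Inf {\<theta>. \<alpha> \<le> ?G \<theta>}"
    by (simp add: M_quantile_def)
  define q where "q = M_quantile \<rho> \<alpha> P"
  have G_q: "\<alpha> \<le> ?G q" and G_below: "\<And>s. s < q \<Longrightarrow> ?G s < \<alpha>"
    using G_cdf cdf_quantile[OF _ \<alpha>] unfolding q_def quantile by auto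
  have minimum: "?O q \<le> ?O \<theta>" for \<theta>
  proof (rule subgradient_sign_change_imp_minimum[OF O_sub])
    show "?D s \<le> 0" if "s < q" for s
      unfolding D_G using G_below[OF that] AB_pos[of s] by (intro mult_nonneg_nonpos) auto
    show "0 \<le> ?D q"
      unfolding D_G using G_q AB_pos[of q] by (intro mult_nonneg_nonneg) auto
  qed

  have continuous_case: "isCont ?G q \<and> ?G q = \<alpha>"
    if reg: "continuous_on UNIV ?\<psi> \<or> (\<forall>x. measure P {x} = 0)"
  proof -
    have "AE \<omega> in M. isCont ?\<psi> (Z \<omega> - q)"
      using reg
    proof
      assume "continuous_on UNIV ?\<psi>"
      then show ?thesis by (simp add: continuous_on_eq_continuous_at)
    next
      assume atom: "\<forall>x. measure P {x} = 0"
      interpret P: prob_space "distr M borel Z" by (rule prob_space_distr) simp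
      have "AE \<omega> in M. Z \<omega> \<notin> (\<lambda>t. t + q) ` {t. \<not> isCont ?\<psi> t}"
        using atom mono_ctble_discont[OF mono_\<psi>]
        by (intro nonatomic_AE_notin_countable) (auto simp: P P.emeasure_eq_measure)
      then show ?thesis by eventually_elim force
    qed
    then have "AE \<omega> in M. isCont (\<lambda>s. ?\<psi> (Z \<omega> - s)) q"
    proof eventually_elim
      case (elim \<omega>)
      then show ?case by (intro isCont_o2[where f = "\<lambda>s. Z \<omega> - s" and g = ?\<psi>]) auto
    qed
    then have cont: "isCont ?G q"
      using AB_pos[of q] unfolding G by (intro continuous_intros continuous_AB) auto
    then have "(?G \<longlongrightarrow> ?G q) (at_left q)"
      by (auto simp: isCont_def intro: tendsto_within_subset)
    moreover have "eventually (\<lambda>s. ?G s \<le> \<alpha>) (at_left q)"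
      using eventually_at_left_real[of "q - 1" q, simplified]
      by eventually_elim (simp add: G_below less_imp_le)
    ultimately have "?G q \<le> \<alpha>" by (rule tendsto_upperbound) simp
    with G_q cont show ?thesis by simp
  qed

  have "?O differentiable (at_left \<theta>)" "?O differentiable (at_right \<theta>)" for \<theta>
    using convex_has_left_deriv[OF O_convex] O_right
    by (auto simp: real_differentiable_def)
  moreover have "sgn (right_deriv ?O \<theta>) = sgn (?G \<theta> - \<alpha>)" for \<theta>
    using AB_pos[of \<theta>] by (simp add: O_right_deriv D_G sgn_mult)
  moreover have "left_deriv ?O \<theta> \<le> right_deriv ?O \<theta>" for \<theta>
    unfolding O_right_deriv by (rule left_deriv_le_right_deriv[OF O_convex O_right])
  ultimately show ?thesis
    using O_int subgradient_imp_continuous[OF O_sub] G_cdf minimum continuous_case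
    unfolding q_def by blast
qed

end
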